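(* Let $k,n,m$ be positive integers with $k\geq 2$, $n\geq k$ and $1\leq m\leq 2n$. Then the $k$-token graph $F_{m,n}^{\{k\}}$ of the generalized fan graph $F_{m,n}=E_m+P_n$ is Hamiltonian.
   Context: All graphs are simple. For a graph $G$ and an integer $k$ with $1\leq k\leq |V(G)|-1$, the $k$-token graph $G^{\{k\}}$ is the graph whose vertices are the $k$-element subsets of $V(G)$, two such subsets being adjacent whenever their symmetric difference is a pair $\{u,v\}$ with $uv\in E(G)$. For disjoint graphs $G,H$, the join $G+H$ has vertex set $V(G)\cup V(H)$ and edge set $E(G)\cup E(H)\cup\{xy: x\in V(G), y\in V(H)\}$. $E_m$ denotes the edgeless graph on $m$ vertices and $P_n$ the path on $n$ vertices; $F_{m,n}=E_m+P_n$ (which has $m+n$ vertices). A graph is Hamiltonian if it has a cycle through every vertex exactly once. *)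

theory Defs
  imports "Graph_Theory.Graph_Theory" "HOL-Library.Ramsey"
begin

text \<open>
  A simple graph is a symmetric loop-free digraph without parallel arcs (locale \<^locale>\<open>pair_graph\<close>):
  an edge \<open>uv\<close> is represented by the two arcs \<open>(u, v)\<close> and \<open>(v, u)\<close>.
\<close>

definition edgeless_graph :: "nat \<Rightarrow> nat pair_pre_digraph" where
  "edgeless_graph m = \<lparr>pverts = {..<m}, parcs = {}\<rparr>"

definition path_graph :: "nat \<Rightarrow> nat pair_pre_digraph" where
  "path_graph n = \<lparr>pverts = {..<n}, parcs = {(i, j). i < n \<and> j < n \<and> (j = Suc i \<or> i = Suc j)}\<rparr>"

text \<open>The two graphs are made disjoint by using the sum type for the vertices of the join.\<close>

definition graph_join :: "'a pair_pre_digraph \<Rightarrow> 'b pair_pre_digraph \<Rightarrow> ('a + 'b) pair_pre_digraph" where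
  "graph_join G H =
    \<lparr>pverts = pverts G <+> pverts H,
     parcs = {(Inl x, Inl y) | x y. (x, y) \<in> parcs G}
           \<union> {(Inr x, Inr y) | x y. (x, y) \<in> parcs H}
           \<union> {(Inl x, Inr y) | x y. x \<in> pverts G \<and> y \<in> pverts H}
           \<union> {(Inr y, Inl x) | x y. x \<in> pverts G \<and> y \<in> pverts H}\<rparr>"

definition fan_graph :: "nat \<Rightarrow> nat \<Rightarrow> (nat + nat) pair_pre_digraph" where
  "fan_graph m n = graph_join (edgeless_graph m) (path_graph n)"

definition token_graph :: "nat \<Rightarrow> 'a pair_pre_digraph \<Rightarrow> 'a set pair_pre_digraph" where
  "token_graph k G =
    \<lparr>pverts = nsets (pverts G) k,
     parcs = {(A, B). A \<in> nsets (pverts G) k \<and> B \<in> nsets (pverts G) k \<and>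
                (\<exists>u v. (u, v) \<in> parcs G \<and> sym_diff A B = {u, v})}\<rparr>"

text \<open>
  The library's \<^const>\<open>pre_digraph.cycle\<close> forbids repeated vertices, but for symmetric digraphs it
  admits the closed walk \<open>a, b, a\<close> along a single edge; the length bound excludes it.
  The tails of the arcs of a cycle are exactly the vertices on it.
\<close>

definition hamiltonian :: "'a pair_pre_digraph \<Rightarrow> bool" where
  "hamiltonian G \<longleftrightarrow>
    (\<exists>p. pre_digraph.cycle (with_proj G) p \<and> 3 \<le> length p \<and> fst ` set p = pverts G)"

lemma pair_graph_fan_graph: "pair_graph (fan_graph m n)"
proof -
  have fin: "finite (pverts (fan_graph m n))"
    by (simp add: fan_graph_def graph_join_def edgeless_graph_def path_graph_def)
  have sub: "parcs (fan_graph m n) \<subseteq> pverts (fan_graph m n) \<times> pverts (fan_graph m n)"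
    by (auto simp: fan_graph_def graph_join_def edgeless_graph_def path_graph_def)
  have "sym (parcs (fan_graph m n))"
    by (auto simp: sym_def fan_graph_def graph_join_def edgeless_graph_def path_graph_def)
  moreover have "\<forall>e \<in> parcs (fan_graph m n). fst e \<noteq> snd e"
    by (auto simp: fan_graph_def graph_join_def edgeless_graph_def path_graph_def)
  moreover have "finite (parcs (fan_graph m n))"
    using finite_subset[OF sub] fin by simp
  ultimately show ?thesis
    using fin sub by unfold_locales (auto simp: symmetric_def)
qed

lemma card_fan_graph: "card (pverts (fan_graph m n)) = m + n"
  by (simp add: fan_graph_def graph_join_def edgeless_graph_def path_graph_def card_Plus)

lemma pair_graph_token_graph:
  assumes "pair_graph G"
  shows "pair_graph (token_graph k G)"
proof -
  interpret pair_graph G by fact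
  have fin: "finite (pverts (token_graph k G))"
    by (simp add: token_graph_def finite_imp_finite_nsets)
  have sub: "parcs (token_graph k G) \<subseteq> pverts (token_graph k G) \<times> pverts (token_graph k G)"
    by (auto simp: token_graph_def)
  have "sym (parcs (token_graph k G))"
    by (auto simp: sym_def token_graph_def Un_commute)
  moreover have "\<forall>e \<in> parcs (token_graph k G). fst e \<noteq> snd e"
    by (auto simp: token_graph_def)
  moreover have "finite (parcs (token_graph k G))"
    using finite_subset[OF sub] fin by simp
  ultimately show ?thesis
    using fin sub by unfold_locales (auto simp: symmetric_def)
qed

end

theory Submission
  imports Defs
begin

text \<open>
  Splitting the \<open>k\<close>-subsets by whether they contain a given vertex \<open>x\<close> splits a token graph into one
  with \<open>k\<close> and one with \<open>k - 1\<close> tokens on fewer vertices, and Hamiltonian cycles of the two parts are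
  merged by exchanging two edges \<open>XY\<close>, \<open>AB\<close> such that \<open>X\<close>, \<open>Y\<close> are adjacent to \<open>A + x\<close>, \<open>B + x\<close>.
  For a single apex \<open>w\<close> one adds the end vertex \<open>x\<close> of the path. Let \<open>y\<close> be the preceding vertex;
  both parts contain a copy of the cycle of \<open>k - 1\<close> tokens on the path without \<open>x\<close>, \<open>y\<close>, each
  with at most one edge destroyed, so a third edge \<open>AB\<close> survives in both, and \<open>X = A + y\<close>, \<open>Y = B + y\<close>
  will do. To add an apex one merges at the edge joining \<open>{0..<k}\<close> to \<open>{0..<k - 1} + w\<close>, where \<open>w\<close> is the
  last apex; the merge creates the corresponding edge for the new one. Only \<open>k = 2\<close> cannot
  be reduced to fewer tokens, as the graph itself need not be Hamiltonian; there a cycle is given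
  explicitly, and \<open>m \<le> 2 n\<close> leaves enough room in it for all pairs of apices.
\<close>

section \<open>Hamiltonian cycles as edge sets\<close>

fun path_edges :: "'a list \<Rightarrow> 'a set set" where
  "path_edges [] = {}"
| "path_edges [x] = {}"
| "path_edges (x # y # zs) = insert {x, y} (path_edges (y # zs))"

definition cycle_edges :: "'a list \<Rightarrow> 'a set set" where
  "cycle_edges xs = insert {hd xs, last xs} (path_edges xs)"

text \<open>Recording a cycle by its edge set makes rotation and reversal invisible and turns the
  survival of an edge into membership. Adjacency is imposed separately, as an inclusion of
  \<open>C\<close> in a set of admissible edges.\<close>

definition ham_cycle :: "'a set \<Rightarrow> 'a set set \<Rightarrow> bool" where
  "ham_cycle V C \<longleftrightarrow> (\<exists>xs. distinct xs \<and> 3 \<le> length xs \<and> set xs = V \<and> C = cycle_edges xs)"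

lemma path_edges_append:
  "xs \<noteq> [] \<Longrightarrow> ys \<noteq> [] \<Longrightarrow>
    path_edges (xs @ ys) = insert {last xs, hd ys} (path_edges xs \<union> path_edges ys)"
proof (induction xs rule: path_edges.induct)
  case (2 x)
  then show ?case by (cases ys) auto
qed auto

lemma path_edges_rev: "path_edges (rev xs) = path_edges xs"
proof (induction xs rule: path_edges.induct)
  case (3 x y zs)
  have "path_edges (rev (x # y # zs)) = path_edges (rev (y # zs) @ [x])" by simp
  also have "\<dots> = insert {y, x} (path_edges (rev (y # zs)))"
    by (subst path_edges_append) auto
  finally show ?case using 3 by (simp add: insert_commute)
qed auto

lemma path_edges_map: "path_edges (map f xs) = image f ` path_edges xs"
  by (induction xs rule: path_edges.induct) auto

lemma path_edges_split:
  "e \<in> path_edges xs \<Longrightarrow> \<exists>ys zs. xs = ys @ zs \<and> ys \<noteq> [] \<and> zs \<noteq> [] \<and> e = {last ys, hd zs}"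
proof (induction xs rule: path_edges.induct)
  case (3 x y zs)
  show ?case
  proof (cases "e = {x, y}")
    case True
    then show ?thesis by (intro exI[of _ "[x]"] exI[of _ "y # zs"]) auto
  next
    case False
    then obtain us vs where "y # zs = us @ vs" "us \<noteq> []" "vs \<noteq> []" "e = {last us, hd vs}"
      using 3 by auto
    then show ?thesis by (intro exI[of _ "x # us"] exI[of _ vs]) auto
  qed
qed auto

lemma path_edges_subset: "e \<in> path_edges xs \<Longrightarrow> e \<subseteq> set xs"
  by (induction xs rule: path_edges.induct) auto

lemma cycle_edges_rev: "xs \<noteq> [] \<Longrightarrow> cycle_edges (rev xs) = cycle_edges xs"
  by (simp add: cycle_edges_def path_edges_rev hd_rev last_rev insert_commute)

lemma cycle_edges_append_commute:
  "xs \<noteq> [] \<Longrightarrow> ys \<noteq> [] \<Longrightarrow> cycle_edges (xs @ ys) = cycle_edges (ys @ xs)"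
  by (simp add: cycle_edges_def path_edges_append insert_commute Un_commute)

lemma cycle_edges_map: "xs \<noteq> [] \<Longrightarrow> cycle_edges (map f xs) = image f ` cycle_edges xs"
  by (simp add: cycle_edges_def path_edges_map hd_map last_map)

lemma ham_cycle_subset:
  assumes "ham_cycle V C" "e \<in> C"
  shows "e \<subseteq> V"
proof -
  obtain xs where xs: "3 \<le> length xs" "set xs = V" "C = cycle_edges xs"
    using assms(1) unfolding ham_cycle_def by blast
  then have "xs \<noteq> []" by auto
  then have "{hd xs, last xs} \<subseteq> V" using xs(2) by auto
  then show ?thesis
    using assms(2) xs path_edges_subset unfolding cycle_edges_def by fastforce
qed

lemma ham_cycle_image:
  assumes "ham_cycle V C" "inj_on f V"
  shows "ham_cycle (f ` V) (image f ` C)"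
proof -
  obtain xs where xs: "distinct xs" "3 \<le> length xs" "set xs = V" "C = cycle_edges xs"
    using assms(1) unfolding ham_cycle_def by blast
  then have "xs \<noteq> []" by auto
  then have "image f ` C = cycle_edges (map f xs)" using cycle_edges_map xs(4) by blast
  moreover have "distinct (map f xs)" using xs assms(2) by (simp add: distinct_map)
  moreover have "set (map f xs) = f ` V" "3 \<le> length (map f xs)" using xs by auto
  ultimately show ?thesis unfolding ham_cycle_def by blast
qed

text \<open>Rotating the list, and reversing it if need be, makes any chosen edge the closing
  one.\<close>

lemma ham_cycle_open:
  assumes "ham_cycle V C" and "{x, y} \<in> C"
  shows "\<exists>xs. distinct xs \<and> 3 \<le> length xs \<and> set xs = V \<and> C = cycle_edges xs
    \<and> hd xs = x \<and> last xs = y"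
proof -
  obtain xs where xs: "distinct xs" "3 \<le> length xs" "set xs = V" "C = cycle_edges xs"
    using assms unfolding ham_cycle_def by blast
  have "\<exists>ys. distinct ys \<and> 3 \<le> length ys \<and> set ys = V \<and> C = cycle_edges ys
    \<and> {x, y} = {hd ys, last ys}"
  proof (cases "{x, y} = {hd xs, last xs}")
    case True
    with xs show ?thesis by blast
  next
    case False
    then have "{x, y} \<in> path_edges xs"
      using assms(2) xs(4) by (auto simp: cycle_edges_def)
    then obtain us vs where "xs = us @ vs" "us \<noteq> []" "vs \<noteq> []" "{x, y} = {last us, hd vs}"
      using path_edges_split by metis
    with xs show ?thesis
      by (intro exI[of _ "vs @ us"]) (auto simp: cycle_edges_append_commute)
  qed
  then obtain ys where ys: "distinct ys" "3 \<le> length ys" "set ys = V" "C = cycle_edges ys"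
    "{x, y} = {hd ys, last ys}" by blast
  from ys(5) consider "hd ys = x" "last ys = y" | "hd ys = y" "last ys = x"
    by (auto simp: doubleton_eq_iff)
  then show ?thesis
  proof cases
    case 1
    with ys show ?thesis by blast
  next
    case 2
    moreover have "ys \<noteq> []" using ys(2) by auto
    ultimately show ?thesis using ys
      by (intro exI[of _ "rev ys"]) (auto simp: cycle_edges_rev hd_rev last_rev)
  qed
qed

text \<open>The edges at the first two vertices of the list are already three distinct ones.\<close>

lemma ham_cycle_third_edge:
  assumes "ham_cycle V C"
  shows "\<exists>g \<in> C. g \<noteq> e \<and> g \<noteq> f"
proof -
  obtain xs where xs: "distinct xs" "3 \<le> length xs" "C = cycle_edges xs"
    using assms unfolding ham_cycle_def by blast
  obtain x y z zs where eq: "xs = x # y # z # zs"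
    using xs(2) by (cases xs; cases "tl xs"; cases "tl (tl xs)") auto
  define l where "l = last (z # zs)"
  have "l \<in> set (z # zs)" unfolding l_def by (rule last_in_set) simp
  then have "l \<noteq> x" "l \<noteq> y" "x \<noteq> y" "y \<noteq> z" "x \<noteq> z" using xs(1) eq by auto
  moreover have "{x, l} \<in> C" "{x, y} \<in> C" "{y, z} \<in> C"
    using xs(3) eq by (auto simp: cycle_edges_def l_def)
  moreover have "{x, y} \<noteq> {y, z}" "{x, l} \<noteq> {y, z}" "{x, y} \<noteq> {x, l}"
    using calculation by (auto simp: doubleton_eq_iff)
  ultimately show ?thesis by metis
qed

text \<open>Both cycles are opened at the given edges and the paths concatenated. The second path
  runs from \<open>b\<close> to \<open>a\<close>, so that \<open>{y, b}\<close> is the junction and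
  \<open>{x, a}\<close> the closing edge.\<close>

lemma ham_cycle_merge:
  assumes "ham_cycle V C" "ham_cycle W D" "V \<inter> W = {}" "{x, y} \<in> C" "{a, b} \<in> D"
  shows "\<exists>E. ham_cycle (V \<union> W) E \<and> C - {{x, y}} \<subseteq> E \<and> D - {{a, b}} \<subseteq> E
    \<and> {x, a} \<in> E \<and> {y, b} \<in> E \<and> E \<subseteq> C \<union> D \<union> {{x, a}, {y, b}}"
proof -
  obtain xs where xs: "distinct xs" "3 \<le> length xs" "set xs = V" "C = cycle_edges xs"
    "hd xs = x" "last xs = y" using ham_cycle_open[OF assms(1,4)] by blast
  obtain ys where ys: "distinct ys" "3 \<le> length ys" "set ys = W" "D = cycle_edges ys"
    "hd ys = b" "last ys = a"
    using ham_cycle_open[OF assms(2)] assms(5) by (metis insert_commute)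
  have ne: "xs \<noteq> []" "ys \<noteq> []" using xs(2) ys(2) by auto
  have "ham_cycle (V \<union> W) (cycle_edges (xs @ ys))"
    unfolding ham_cycle_def using xs ys assms(3) by (intro exI[of _ "xs @ ys"]) auto
  then show ?thesis
    by (rule_tac exI, intro conjI, assumption)
      (auto simp: cycle_edges_def path_edges_append xs(4-6) ys(4-6) ne insert_commute)
qed

text \<open>Counterpart of the merge for a single vertex: \<open>v\<close> subdivides the edge
  \<open>{x, y}\<close>.\<close>

lemma ham_cycle_insert:
  assumes "ham_cycle V C" "v \<notin> V" "{x, y} \<in> C"
  shows "\<exists>E. ham_cycle (insert v V) E \<and> C - {{x, y}} \<subseteq> E
    \<and> {x, v} \<in> E \<and> {y, v} \<in> E \<and> E \<subseteq> C \<union> {{x, v}, {y, v}}"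
proof -
  obtain xs where xs: "distinct xs" "3 \<le> length xs" "set xs = V" "C = cycle_edges xs"
    "hd xs = x" "last xs = y" using ham_cycle_open[OF assms(1,3)] by blast
  have ne: "xs \<noteq> []" using xs(2) by auto
  have "ham_cycle (insert v V) (cycle_edges (xs @ [v]))"
    unfolding ham_cycle_def using xs assms(2) by (intro exI[of _ "xs @ [v]"]) auto
  then show ?thesis
    by (rule_tac exI, intro conjI, assumption)
      (auto simp: cycle_edges_def path_edges_append xs(4-6) ne insert_commute)
qed

text \<open>Each new vertex \<open>u\<close> subdivides its own edge \<open>s u\<close>; as
  \<open>s\<close> is injective, that edge is still present when the turn of \<open>u\<close>
  comes.\<close>

lemma ham_cycle_insert_set:
  assumes "finite U" "ham_cycle V C" "U \<inter> V = {}" "inj_on s U" "s ` U \<subseteq> C"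
    and adj: "\<And>u x. u \<in> U \<Longrightarrow> x \<in> s u \<Longrightarrow> {x, u} \<in> R"
    and "C \<subseteq> R" and pairs: "\<And>e. e \<in> R \<Longrightarrow> \<exists>x y. e = {x, y}"
  shows "\<exists>E. ham_cycle (U \<union> V) E \<and> E \<subseteq> R \<and> C - s ` U \<subseteq> E"
  using assms(1,3-6)
proof (induction U rule: finite_induct)
  case empty
  then show ?case using assms(2,7) by auto
next
  case (insert u U)
  obtain E where E: "ham_cycle (U \<union> V) E" "E \<subseteq> R" "C - s ` U \<subseteq> E"
    using insert.IH insert.prems by auto
  have "s u \<in> C - s ` U" using insert.prems insert.hyps by auto
  then have su: "s u \<in> E" using E(3) by auto
  then obtain x y where xy: "s u = {x, y}" using pairs E(2) by blast
  have "u \<notin> U \<union> V" using insert by auto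
  then obtain E' where E': "ham_cycle (insert u (U \<union> V)) E'" "E - {{x, y}} \<subseteq> E'"
    "E' \<subseteq> E \<union> {{x, u}, {y, u}}"
    using ham_cycle_insert[OF E(1), of u x y] su xy by metis
  have "E' \<subseteq> R" using E'(3) E(2) insert.prems(4)[of u] xy by auto
  moreover have "C - s ` insert u U \<subseteq> E'" using E(3) E'(2) xy by auto
  ultimately show ?case using E'(1) by auto
qed

section \<open>Token moves\<close>

text \<open>Adjacency in the fan with infinitely many apices (\<open>Inl\<close>) and a one-way
  infinite path (\<open>Inr\<close>). Every \<open>fan_graph m n\<close> is an induced subgraph, so
  one relation serves all sizes during the inductions.\<close>

fun fan_adj :: "nat + nat \<Rightarrow> nat + nat \<Rightarrow> bool" where
  "fan_adj (Inl _) (Inl _) = False"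
| "fan_adj (Inl _) (Inr _) = True"
| "fan_adj (Inr _) (Inl _) = True"
| "fan_adj (Inr i) (Inr j) = (j = Suc i \<or> i = Suc j)"

definition slide :: "(nat + nat) set \<Rightarrow> (nat + nat) set \<Rightarrow> bool" where
  "slide A B \<longleftrightarrow>
    (\<exists>S u v. u \<notin> S \<and> v \<notin> S \<and> fan_adj u v \<and> A = insert u S \<and> B = insert v S)"

definition slides :: "(nat + nat) set set set" where
  "slides = {{A, B} | A B. slide A B}"

lemma fan_adj_sym: "fan_adj u v \<Longrightarrow> fan_adj v u"
  by (cases "(u, v)" rule: fan_adj.cases) auto

lemma slide_sym: "slide A B \<Longrightarrow> slide B A"
  unfolding slide_def by (blast intro: fan_adj_sym)

lemma slidesI: "slide A B \<Longrightarrow> {A, B} \<in> slides"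
  unfolding slides_def by blast

lemma slidesD: "{A, B} \<in> slides \<Longrightarrow> slide A B"
  unfolding slides_def by (auto simp: doubleton_eq_iff dest: slide_sym)

lemma slidesE:
  assumes "e \<in> slides"
  obtains A B where "e = {A, B}" "slide A B"
  using assms unfolding slides_def by blast

lemma slideI: "u \<notin> S \<Longrightarrow> v \<notin> S \<Longrightarrow> fan_adj u v \<Longrightarrow> slide (insert u S) (insert v S)"
  unfolding slide_def by blast

lemma slide_insert:
  assumes "slide A B" "x \<notin> A" "x \<notin> B"
  shows "slide (insert x A) (insert x B)"
proof -
  obtain S u v where S: "u \<notin> S" "v \<notin> S" "fan_adj u v" "A = insert u S" "B = insert v S"
    using assms(1) unfolding slide_def by blast
  have "slide (insert u (insert x S)) (insert v (insert x S))"
    using S assms by (intro slideI) auto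
  then show ?thesis using S by (simp add: insert_commute)
qed

lemma slides_insert:
  assumes "e \<in> slides" "x \<notin> \<Union>e"
  shows "insert x ` e \<in> slides"
  using assms by (elim slidesE) (auto intro!: slidesI slide_insert)

section \<open>Splitting token configurations at a vertex\<close>

lemma nsets_insert:
  assumes "x \<notin> U"
  shows "nsets (insert x U) (Suc k) = nsets U (Suc k) \<union> insert x ` nsets U k"
proof (intro equalityI subsetI)
  fix A assume A: "A \<in> nsets (insert x U) (Suc k)"
  show "A \<in> nsets U (Suc k) \<union> insert x ` nsets U k"
  proof (cases "x \<in> A")
    case True
    then have "A - {x} \<in> nsets U k" using A by (auto simp: nsets_def)
    moreover have "A = insert x (A - {x})" using True by auto
    ultimately show ?thesis by blast
  next
    case False
    then show ?thesis using A by (auto simp: nsets_def)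
  qed
next
  fix A assume "A \<in> nsets U (Suc k) \<union> insert x ` nsets U k"
  then show "A \<in> nsets (insert x U) (Suc k)"
    using assms by (auto simp: nsets_def card_insert_if)
qed

lemma inj_on_insert_nsets: "x \<notin> U \<Longrightarrow> inj_on (insert x) (nsets U k)"
  by (auto simp: inj_on_def nsets_def)

lemma nsets_disjoint_insert: "x \<notin> U \<Longrightarrow> nsets U j \<inter> insert x ` nsets U k = {}"
  by (auto simp: nsets_def)

lemma slides_insert_cycle:
  assumes "ham_cycle (nsets U k) C" "C \<subseteq> slides" "x \<notin> U"
  shows "image (insert x) ` C \<subseteq> slides"
proof
  fix e assume "e \<in> image (insert x) ` C"
  then obtain f where f: "f \<in> C" "e = insert x ` f" by blast
  have "f \<subseteq> nsets U k" using ham_cycle_subset[OF assms(1) f(1)] .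
  then have "x \<notin> \<Union>f" using assms(3) by (auto simp: nsets_def)
  then show "e \<in> slides" using f assms(2) slides_insert by blast
qed

text \<open>The configurations with a token on \<open>x\<close> carry a shifted copy of
  \<open>D\<close>, which is merged with \<open>C\<close>. The surviving and the new edges are
  recorded because later merges take place at them.\<close>

lemma ham_cycle_tokens_merge:
  assumes C: "ham_cycle (nsets U (Suc k)) C" "C \<subseteq> slides"
    and D: "ham_cycle (nsets U k) D" "D \<subseteq> slides"
    and "x \<notin> U" "{X, Y} \<in> C" "{A, B} \<in> D" "slide X (insert x A)" "slide Y (insert x B)"
  shows "\<exists>E. ham_cycle (nsets (insert x U) (Suc k)) E \<and> E \<subseteq> slides
    \<and> C - {{X, Y}} \<subseteq> E \<and> image (insert x) ` D - {{insert x A, insert x B}} \<subseteq> E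
    \<and> {X, insert x A} \<in> E \<and> {Y, insert x B} \<in> E"
proof -
  let ?D = "image (insert x) ` D"
  have "ham_cycle (insert x ` nsets U k) ?D"
    using D(1) assms(5) by (intro ham_cycle_image inj_on_insert_nsets)
  moreover have "{insert x A, insert x B} \<in> ?D" using imageI[OF assms(7), of "image (insert x)"] by simp
  ultimately obtain E where E: "ham_cycle (nsets U (Suc k) \<union> insert x ` nsets U k) E"
    "C - {{X, Y}} \<subseteq> E" "?D - {{insert x A, insert x B}} \<subseteq> E"
    "{X, insert x A} \<in> E" "{Y, insert x B} \<in> E"
    "E \<subseteq> C \<union> ?D \<union> {{X, insert x A}, {Y, insert x B}}"
    using ham_cycle_merge[OF C(1) _ nsets_disjoint_insert[OF assms(5)] assms(6)] by metis
  moreover have "E \<subseteq> slides"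
    using E(6) C(2) slides_insert_cycle[OF D assms(5)] assms(8,9) by (auto intro: slidesI)
  ultimately show ?thesis using assms(5) by (auto simp: nsets_insert)
qed

section \<open>The fan with a single apex\<close>

definition fan_verts :: "nat \<Rightarrow> nat \<Rightarrow> (nat + nat) set" where
  "fan_verts w n = insert (Inl w) (Inr ` {..<n})"

text \<open>One token moves between path vertex \<open>k - 1\<close> and apex \<open>w\<close> while
  the others rest on the initial segment before it.\<close>

definition corner_edge :: "nat \<Rightarrow> nat \<Rightarrow> (nat + nat) set set" where
  "corner_edge w k = {Inr ` {..<k}, insert (Inl w) (Inr ` {..<k - 1})}"

text \<open>The clause for \<open>k = 2\<close> supplies an edge with \<open>w\<close> in both ends.
  The two-token construction opens the cycle there, since both ends are adjacent to every pair of
  \<open>w\<close> and another apex.\<close>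

definition fan_cycle :: "nat \<Rightarrow> nat \<Rightarrow> nat \<Rightarrow> (nat + nat) set set set \<Rightarrow> bool" where
  "fan_cycle w n k C \<longleftrightarrow> ham_cycle (nsets (fan_verts w n) k) C \<and> C \<subseteq> slides
    \<and> corner_edge w k \<in> C \<and> (k = 2 \<longrightarrow> {{Inl w, Inr 0}, {Inl w, Inr 1}} \<in> C)"

text \<open>
  The path has \<open>Suc n\<close> vertices here, the last one being \<open>n\<close>.
  The last clause provides the two parallel edges at which the cycles of \<open>k\<close> and \<open>k - 1\<close> tokens
  are merged when the path grows by one vertex.
\<close>

definition fan_family :: "nat \<Rightarrow> nat \<Rightarrow> (nat \<Rightarrow> (nat + nat) set set set) \<Rightarrow> bool" where
  "fan_family w n H \<longleftrightarrow> (\<forall>k. 1 \<le> k \<longrightarrow> k \<le> Suc n \<longrightarrow> fan_cycle w (Suc n) k (H k))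
    \<and> {{Inl w}, {Inr n}} \<in> H 1
    \<and> (\<forall>k. 2 \<le> k \<longrightarrow> k \<le> Suc n \<longrightarrow>
        (\<exists>A B. Inr n \<notin> A \<and> Inr n \<notin> B \<and> {A, B} \<in> H (k - 1)
          \<and> {insert (Inr n) A, insert (Inr n) B} \<in> H k))"

lemma fan_verts_Suc: "fan_verts w (Suc n) = insert (Inr n) (fan_verts w n)"
  by (auto simp: fan_verts_def lessThan_Suc)

lemma notin_fan_verts: "n \<le> i \<Longrightarrow> Inr i \<notin> fan_verts w n"
  by (auto simp: fan_verts_def)

lemma finite_fan_verts: "finite (fan_verts w n)"
  by (simp add: fan_verts_def)

lemma card_fan_verts: "card (fan_verts w n) = Suc n"
proof -
  have "Inl w \<notin> Inr ` {..<n}" by auto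
  then show ?thesis by (simp add: fan_verts_def card_image)
qed

lemma nsets_card_eq: "finite U \<Longrightarrow> card U = k \<Longrightarrow> nsets U k = {U}"
  by (auto simp: nsets_def dest: card_subset_eq)

lemma nsets_Suc_0: "nsets U (Suc 0) = (\<lambda>u. {u}) ` U"
  by (auto simp: nsets_def card_Suc_eq)

lemma nsets_empty_Suc: "nsets {} (Suc k) = {}"
  by (auto simp: nsets_def)

text \<open>This fan is a triangle, and taking complements shows that its 2-token graph is a
  triangle as well.\<close>

lemma fan_family_2: "\<exists>H. fan_family w 1 H"
proof -
  define a b c :: "nat + nat" where "a = Inl w" and "b = Inr 0" and "c = Inr 1"
  have ne: "a \<noteq> b" "a \<noteq> c" "b \<noteq> c" by (auto simp: a_def b_def c_def)
  have U: "fan_verts w 2 = {a, b, c}"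
    by (auto simp: fan_verts_def a_def b_def c_def numeral_2_eq_2 lessThan_Suc)
  have adj: "fan_adj a b" "fan_adj a c" "fan_adj b c" by (auto simp: a_def b_def c_def)
  let ?L = "[{a}, {b}, {c}]" and ?M = "[{b, c}, {a, b}, {a, c}]"
  define H where "H = (\<lambda>k::nat. if k = 1 then cycle_edges ?L else cycle_edges ?M)"
  have V1: "nsets {a, b, c} (Suc 0) = set ?L"
    by (auto simp: nsets_Suc_0)
  have V2: "nsets {a, b, c} 2 = set ?M"
    using ne by (auto simp: numeral_2_eq_2 nsets_insert nsets_Suc_0 nsets_empty_Suc)
  have C1: "ham_cycle (nsets {a, b, c} (Suc 0)) (cycle_edges ?L)"
    unfolding ham_cycle_def V1 using ne by (intro exI[of _ ?L]) auto
  have C2: "ham_cycle (nsets {a, b, c} 2) (cycle_edges ?M)"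
    unfolding ham_cycle_def V2 using ne by (intro exI[of _ ?M]) (auto simp: doubleton_eq_iff)
  have s1: "slide {a} {b}" "slide {b} {c}" "slide {a} {c}"
    using slideI[of _ "{}"] adj by auto
  have s2: "slide {b, c} {a, b}" "slide {a, b} {a, c}" "slide {b, c} {a, c}"
    using slide_insert[OF s1(3), of b] slide_insert[OF s1(2), of a] slide_insert[OF s1(1), of c] ne
    by (auto simp: insert_commute intro: slide_sym)
  have S1: "cycle_edges ?L \<subseteq> slides" using s1 by (auto simp: cycle_edges_def intro: slidesI)
  have S2: "cycle_edges ?M \<subseteq> slides" using s2 by (auto simp: cycle_edges_def intro: slidesI)
  have e1: "corner_edge w 1 = {{a}, {b}}"
    by (auto simp: corner_edge_def a_def b_def lessThan_Suc)
  have e2: "corner_edge w 2 = {{b, c}, {a, b}}"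
    by (auto simp: corner_edge_def a_def b_def c_def lessThan_Suc numeral_2_eq_2)
  have "fan_cycle w 2 1 (H 1)"
    unfolding fan_cycle_def U e1 H_def using C1 S1 by (simp add: cycle_edges_def)
  moreover have "fan_cycle w 2 2 (H 2)"
    unfolding fan_cycle_def U e2 H_def using C2 S2
    by (simp add: cycle_edges_def a_def b_def c_def)
  ultimately have "\<forall>k. 1 \<le> k \<longrightarrow> k \<le> 2 \<longrightarrow> fan_cycle w 2 k (H k)"
    by (metis One_nat_def Suc_1 le_SucE le_antisym)
  moreover have "{{a}, {c}} \<in> H 1" by (simp add: H_def cycle_edges_def)
  moreover have "\<exists>A B. c \<notin> A \<and> c \<notin> B \<and> {A, B} \<in> H (k - 1) \<and> {insert c A, insert c B} \<in> H k"
    if "2 \<le> k" "k \<le> 2" for k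
  proof -
    have "k = 2" using that by simp
    then show ?thesis using ne
      by (intro exI[of _ "{a}"] exI[of _ "{b}"]) (auto simp: H_def cycle_edges_def insert_commute)
  qed
  ultimately show ?thesis
    unfolding fan_family_def a_def c_def by (auto simp: numeral_2_eq_2)
qed

text \<open>The clauses with \<open>f\<close> say that growing the path destroys at most one edge in
  the old cycle for \<open>k\<close> and at most one in the shifted cycle for
  \<open>k - 1\<close>.\<close>

lemma fan_cycle_extend:
  assumes H: "fan_family w n H" and n: "1 \<le> n" and k: "1 \<le> k" "k \<le> Suc (Suc n)"
  shows "\<exists>C. fan_cycle w (Suc (Suc n)) k C
    \<and> (k \<le> Suc n \<longrightarrow> (\<exists>f. H k - {f} \<subseteq> C))
    \<and> (2 \<le> k \<longrightarrow> (\<exists>f. image (insert (Inr (Suc n))) ` H (k - 1) - {f} \<subseteq> C))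
    \<and> (k = 1 \<longrightarrow> {{Inl w}, {Inr (Suc n)}} \<in> C)"
proof -
  define U where "U = fan_verts w (Suc n)"
  define x y :: "nat + nat" where "x = Inr (Suc n)" and "y = Inr n"
  have x: "x \<notin> U" and y: "y \<in> U"
    by (auto simp: U_def x_def y_def fan_verts_def)
  have U': "fan_verts w (Suc (Suc n)) = insert x U"
    by (simp add: fan_verts_Suc[of w "Suc n"] U_def x_def)
  have cyc: "ham_cycle (nsets U j) (H j)" "H j \<subseteq> slides" "corner_edge w j \<in> H j"
    if "1 \<le> j" "j \<le> Suc n" for j
    using H that unfolding fan_family_def fan_cycle_def U_def by blast+
  consider "k = 1" | "2 \<le> k" "k \<le> Suc n" | "k = Suc (Suc n)" using k by linarith
  then show ?thesis
  proof cases
    case 1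
    \<comment> \<open>A single token: \<open>{x}\<close> subdivides the edge from the apex to the
      former end \<open>y\<close> of the path, which leaves the edge from the apex to the new
      end.\<close>
    have wy: "{{Inl w}, {y}} \<in> H 1" using H by (simp add: fan_family_def y_def)
    have "{x} \<notin> nsets U 1" using x by (auto simp: nsets_def)
    from ham_cycle_insert[OF cyc(1)[of 1] this wy] obtain E where E: "ham_cycle (insert {x} (nsets U 1)) E"
      "H 1 - {{{Inl w}, {y}}} \<subseteq> E" "{{Inl w}, {x}} \<in> E"
      "E \<subseteq> H 1 \<union> {{{Inl w}, {x}}, {{y}, {x}}}"
      by auto
    have "nsets (insert x U) 1 = insert {x} (nsets U 1)"
      by (auto simp: nsets_Suc_0)
    moreover have "slide {Inl w} {x}" "slide {y} {x}"
      by (auto intro!: slideI simp: x_def y_def)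
    then have "E \<subseteq> slides" using E(4) cyc(2)[of 1] by (auto intro: slidesI)
    moreover have "corner_edge w 1 \<noteq> {{Inl w}, {y}}"
      using n by (auto simp: corner_edge_def y_def doubleton_eq_iff lessThan_Suc)
    then have "corner_edge w 1 \<in> E" using E(2) cyc(3)[of 1] by auto
    ultimately have "fan_cycle w (Suc (Suc n)) 1 E"
      unfolding fan_cycle_def U' using E(1) by simp
    then show ?thesis using E(2,3) 1 unfolding x_def by (intro exI[of _ E]) auto
  next
    case 2
    \<comment> \<open>The parallel edges kept by the family: moving the token on \<open>y\<close> to
      \<open>x\<close> leads from \<open>A + y\<close>, \<open>B + y\<close> to
      \<open>A + x\<close>, \<open>B + x\<close>.\<close>
    then obtain A B where AB: "y \<notin> A" "y \<notin> B" "{A, B} \<in> H (k - 1)"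
      "{insert y A, insert y B} \<in> H k"
      using H unfolding fan_family_def y_def by blast
    have sub: "{A, B} \<subseteq> nsets U (k - 1)"
      using ham_cycle_subset[OF cyc(1) AB(3)] 2 by auto
    then have xAB: "x \<notin> A" "x \<notin> B" using x by (auto simp: nsets_def)
    then have "slide (insert y A) (insert x A)" "slide (insert y B) (insert x B)"
      using AB by (auto intro!: slideI simp: x_def y_def)
    moreover have "Suc (k - 1) = k" using 2 by simp
    ultimately obtain E where E: "ham_cycle (nsets (insert x U) k) E" "E \<subseteq> slides"
      "H k - {{insert y A, insert y B}} \<subseteq> E"
      "image (insert x) ` H (k - 1) - {{insert x A, insert x B}} \<subseteq> E"
      using ham_cycle_tokens_merge[of U "k - 1" "H k" "H (k - 1)" x "insert y A" "insert y B" A B]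
        cyc[of k] cyc[of "k - 1"] 2 x AB(3,4) by auto
    \<comment> \<open>Both ends of the destroyed edge contain \<open>y\<close>, so an edge with one
      end avoiding \<open>y\<close> survives.\<close>
    have yin: "Z \<in> e \<Longrightarrow> y \<notin> Z \<Longrightarrow> e \<noteq> {insert y A, insert y B}" for Z e by auto
    have "y \<notin> insert (Inl w) (Inr ` {..<k - 1})" using 2 by (auto simp: y_def)
    then have "corner_edge w k \<noteq> {insert y A, insert y B}"
      by (rule yin[rotated]) (simp add: corner_edge_def)
    then have "corner_edge w k \<in> E" using E(3) cyc(3)[of k] 2 by auto
    moreover have "{{Inl w, Inr 0}, {Inl w, Inr 1}} \<in> E" if "k = 2"
    proof -
      have "y \<notin> {Inl w, Inr 0}" using n by (auto simp: y_def)
      then have "{{Inl w, Inr 0}, {Inl w, Inr 1}} \<noteq> {insert y A, insert y B}"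
        by (rule yin[rotated]) simp
      moreover have "{{Inl w, Inr 0}, {Inl w, Inr 1}} \<in> H k"
        using H 2 that unfolding fan_family_def fan_cycle_def
        by (metis One_nat_def Suc_1 Suc_leD)
      ultimately show ?thesis using subsetD[OF E(3)] by (simp only: Diff_iff singleton_iff simp_thms)
    qed
    ultimately have "fan_cycle w (Suc (Suc n)) k E"
      unfolding fan_cycle_def U' using E(1,2) by (intro conjI) simp_all
    moreover have "k \<noteq> 1" using 2 by simp
    ultimately show ?thesis using E(3,4) unfolding x_def by blast
  next
    case 3
    \<comment> \<open>Only the set \<open>U\<close> has no token on \<open>x\<close>. It subdivides
      the shifted corner edge: moving the token from \<open>x\<close> to \<open>w\<close> or to
      \<open>y\<close> turns \<open>P + x\<close> or \<open>Q + x\<close> into \<open>U\<close>. The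
      half at \<open>P + x\<close> is the new corner edge.\<close>
    define P Q where "P = (Inr ` {..<Suc n} :: (nat + nat) set)"
      and "Q = insert (Inl w) (Inr ` {..<n} :: (nat + nat) set)"
    have UP: "U = insert (Inl w) P" by (simp add: U_def P_def fan_verts_def)
    have UQ: "U = insert y Q" by (auto simp: U_def Q_def y_def fan_verts_def)
    have PQ: "{P, Q} \<in> H (Suc n)"
      using cyc(3)[of "Suc n"] by (simp add: corner_edge_def P_def Q_def)
    let ?D = "image (insert x) ` H (Suc n)"
    have "ham_cycle (insert x ` nsets U (Suc n)) ?D"
      using cyc(1)[of "Suc n"] x by (intro ham_cycle_image inj_on_insert_nsets) auto
    moreover have "U \<notin> insert x ` nsets U (Suc n)" using x by auto
    moreover have "{insert x P, insert x Q} \<in> ?D"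
      using imageI[OF PQ, of "image (insert x)"] by simp
    ultimately obtain E where E: "ham_cycle (insert U (insert x ` nsets U (Suc n))) E"
      "?D - {{insert x P, insert x Q}} \<subseteq> E" "{insert x P, U} \<in> E"
      "E \<subseteq> ?D \<union> {{insert x P, U}, {insert x Q, U}}"
      using ham_cycle_insert by metis
    have "nsets U (Suc (Suc n)) = {U}"
      by (intro nsets_card_eq) (simp_all add: U_def finite_fan_verts card_fan_verts)
    then have "nsets (insert x U) k = insert U (insert x ` nsets U (Suc n))"
      using x 3 by (simp add: nsets_insert)
    moreover have "slide (insert x P) (insert (Inl w) P)" "slide (insert x Q) (insert y Q)"
      by (rule slideI; auto simp: P_def Q_def x_def y_def)+
    then have "{insert x P, U} \<in> slides" "{insert x Q, U} \<in> slides"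
      by (simp_all only: UP[symmetric] UQ[symmetric] slidesI)
    then have "E \<subseteq> slides"
      using E(4) slides_insert_cycle[OF cyc(1,2) x, of "Suc n"] by auto
    moreover have "corner_edge w k = {insert x P, U}"
      unfolding UP by (auto simp: corner_edge_def P_def x_def 3 lessThan_Suc)
    then have "corner_edge w k \<in> E" using E(3) by simp
    ultimately have "fan_cycle w (Suc (Suc n)) k E"
      unfolding fan_cycle_def U' using E(1) 3 n by simp
    moreover have "\<not> k \<le> Suc n" "k - 1 = Suc n" "k \<noteq> 1" using 3 by simp_all
    ultimately show ?thesis using E(2) unfolding x_def by metis
  qed
qed

lemma fan_family_Suc:
  assumes H: "fan_family w n H" and n: "1 \<le> n"
  shows "\<exists>H'. fan_family w (Suc n) H'"
proof -
  define x :: "nat + nat" where "x = Inr (Suc n)"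
  obtain H' where H': "\<And>k. 1 \<le> k \<Longrightarrow> k \<le> Suc (Suc n) \<Longrightarrow> fan_cycle w (Suc (Suc n)) k (H' k)"
    "\<And>k. 1 \<le> k \<Longrightarrow> k \<le> Suc n \<Longrightarrow> \<exists>f. H k - {f} \<subseteq> H' k"
    "\<And>k. 2 \<le> k \<Longrightarrow> k \<le> Suc (Suc n) \<Longrightarrow> \<exists>f. image (insert x) ` H (k - 1) - {f} \<subseteq> H' k"
    "{{Inl w}, {x}} \<in> H' 1"
  proof -
    define P where "P k C \<longleftrightarrow> fan_cycle w (Suc (Suc n)) k C
      \<and> (k \<le> Suc n \<longrightarrow> (\<exists>f. H k - {f} \<subseteq> C))
      \<and> (2 \<le> k \<longrightarrow> (\<exists>f. image (insert x) ` H (k - 1) - {f} \<subseteq> C))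
      \<and> (k = 1 \<longrightarrow> {{Inl w}, {x}} \<in> C)" for k C
    have "\<forall>k \<in> {1..Suc (Suc n)}. \<exists>C. P k C"
      unfolding P_def x_def by (intro ballI fan_cycle_extend[OF H n]) simp_all
    from bchoice[OF this] obtain G where "\<forall>k \<in> {1..Suc (Suc n)}. P k (G k)" ..
    then have "P k (G k)" if "1 \<le> k" "k \<le> Suc (Suc n)" for k using that by simp
    note G' = this[unfolded P_def]
    show ?thesis
    proof (rule that[of G])
      show "fan_cycle w (Suc (Suc n)) k (G k)" if "1 \<le> k" "k \<le> Suc (Suc n)" for k
        using G'[OF that] by (rule conjunct1)
      show "\<exists>f. H k - {f} \<subseteq> G k" if "1 \<le> k" "k \<le> Suc n" for k
        using G'[OF that(1) le_SucI[OF that(2)]] that(2) by (elim conjE) (erule mp)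
      show "\<exists>f. image (insert x) ` H (k - 1) - {f} \<subseteq> G k" if "2 \<le> k" "k \<le> Suc (Suc n)" for k
        using G'[of k] that by (metis One_nat_def Suc_1 Suc_leD)
      show "{{Inl w}, {x}} \<in> G 1" using G'[of 1] by simp
    qed
  qed
  have "\<exists>A B. x \<notin> A \<and> x \<notin> B \<and> {A, B} \<in> H' (k - 1) \<and> {insert x A, insert x B} \<in> H' k"
    if k: "2 \<le> k" "k \<le> Suc (Suc n)" for k
  proof -
    have k1: "1 \<le> k - 1" "k - 1 \<le> Suc n" using k by linarith+
    \<comment> \<open>\<open>H (k - 1)\<close> survives in \<open>H' (k - 1)\<close> up to the edge
      \<open>f\<close>, and its copy shifted by \<open>x\<close> survives in \<open>H' k\<close> up
      to \<open>g\<close>.\<close>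
    obtain f where f: "H (k - 1) - {f} \<subseteq> H' (k - 1)" using H'(2)[OF k1] ..
    obtain g where g: "image (insert x) ` H (k - 1) - {g} \<subseteq> H' k" using H'(3)[OF k] ..
    have "fan_cycle w (Suc n) (k - 1) (H (k - 1))" using H k1 by (simp add: fan_family_def)
    then have cyc: "ham_cycle (nsets (fan_verts w (Suc n)) (k - 1)) (H (k - 1))"
      "H (k - 1) \<subseteq> slides" by (auto simp: fan_cycle_def)
    \<comment> \<open>Deleting \<open>x\<close> recovers the only edge whose shifted copy could be \<open>g\<close>.\<close>
    obtain e where e: "e \<in> H (k - 1)" "e \<noteq> f" "e \<noteq> (\<lambda>A. A - {x}) ` g"
      using ham_cycle_third_edge[OF cyc(1), of f "(\<lambda>A. A - {x}) ` g"] by (elim bexE conjE)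
    obtain A B where AB: "e = {A, B}" by (rule slidesE[OF subsetD[OF cyc(2) e(1)]])
    have "{A, B} \<subseteq> nsets (fan_verts w (Suc n)) (k - 1)"
      using ham_cycle_subset[OF cyc(1) e(1)] AB by simp
    then have x: "x \<notin> A" "x \<notin> B"
      using notin_fan_verts[of "Suc n" "Suc n" w] by (auto simp: nsets_def x_def)
    then have "(\<lambda>A. A - {x}) ` {insert x A, insert x B} = e" using AB by simp
    then have "{insert x A, insert x B} \<noteq> g" using e(3) by metis
    moreover have "{insert x A, insert x B} \<in> image (insert x) ` H (k - 1)"
      using imageI[OF e(1), of "image (insert x)"] AB by simp
    ultimately have "{insert x A, insert x B} \<in> H' k" by (intro subsetD[OF g] DiffI) simp_all
    moreover have "{A, B} \<in> H' (k - 1)"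
      using e(1,2) unfolding AB by (intro subsetD[OF f] DiffI) simp_all
    ultimately show ?thesis using x by (intro exI conjI)
  qed
  then have "fan_family w (Suc n) H'"
    unfolding fan_family_def x_def[symmetric] using H'(1,4)
    by (intro conjI allI impI) simp_all
  then show ?thesis by (rule exI[of _ H'])
qed

lemma fan_family_exists: "1 \<le> n \<Longrightarrow> \<exists>H. fan_family w n H"
  by (induction n rule: dec_induct) (auto intro: fan_family_2 fan_family_Suc simp del: One_nat_def)

lemma fan_cycle_exists:
  assumes "1 \<le> k" "k \<le> n" "2 \<le> n"
  shows "\<exists>C. fan_cycle w n k C"
proof -
  have "1 \<le> n - 1" using assms by linarith
  then obtain H where "fan_family w (n - 1) H" using fan_family_exists by blast
  then show ?thesis using assms by (auto simp: fan_family_def)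
qed

section \<open>Two tokens\<close>

definition all_verts :: "nat \<Rightarrow> nat \<Rightarrow> (nat + nat) set" where
  "all_verts m n = Inl ` {..<m} \<union> Inr ` {..<n}"

definition corner_cycle :: "nat \<Rightarrow> nat \<Rightarrow> nat \<Rightarrow> (nat + nat) set set set \<Rightarrow> bool" where
  "corner_cycle m n k C \<longleftrightarrow> ham_cycle (nsets (all_verts m n) k) C \<and> C \<subseteq> slides
    \<and> corner_edge (m - 1) k \<in> C"

text \<open>The final pair of apices is the link to the next row: it is adjacent to
  \<open>{Inl (Suc a), Inr 0}\<close>.\<close>

definition row :: "nat \<Rightarrow> nat \<Rightarrow> (nat + nat) set list" where
  "row n a = map (\<lambda>i. {Inl a, Inr i}) [0..<n] @ [{Inl a, Inl (Suc a)}]"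

text \<open>Both ends contain apex \<open>a\<close>, so any pair of \<open>a\<close> and another
  apex can be inserted here.\<close>

definition row_edge :: "nat \<times> nat \<Rightarrow> (nat + nat) set set" where
  "row_edge = (\<lambda>(a, i). {{Inl a, Inr i}, {Inl a, Inr (Suc i)}})"

text \<open>
  The pair inserted into the edge \<open>row_edge (a, i)\<close>. Up to boundary effects this is the circular
  tournament on \<open>{..<M}\<close>: \<open>a\<close> receives the pairs \<open>{a, b}\<close> with \<open>2 \<le> b - a \<le> M div 2\<close> modulo \<open>M\<close>,
  the pairs at distance \<open>1\<close> being already used to pass from one row to the next.
\<close>

definition slot_pair :: "nat \<Rightarrow> nat \<times> nat \<Rightarrow> (nat + nat) set" where
  "slot_pair M = (\<lambda>(a, i). {Inl a, Inl (if i = 0 \<and> Suc a \<noteq> M then M else (a + i + 1) mod M)})"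

lemma path_edges_map_upt:
  "path_edges (map f [0..<n]) = (\<lambda>i. {f i, f (Suc i)}) ` {i. Suc i < n}"
proof (induction n)
  case (Suc n)
  show ?case
  proof (cases n)
    case (Suc j)
    have "{i. Suc i < Suc n} = insert j {i. Suc i < n}" using Suc by auto
    moreover have "path_edges (map f [0..<n] @ [f n])
        = insert {f j, f n} (path_edges (map f [0..<n]))"
      by (subst path_edges_append) (auto simp: Suc)
    ultimately show ?thesis using Suc.IH Suc by simp
  qed auto
qed auto

lemma slide_pair_apex: "slide {Inl a, Inr i} {Inl a, Inl b}" if "b \<noteq> a"
  using slideI[of "Inr i" "{Inl a}" "Inl b"] that by (auto simp: insert_commute)

lemma slide_pair_path: "slide {Inl a, Inr i} {Inl a, Inr (Suc i)}"
  using slideI[of "Inr i" "{Inl a}" "Inr (Suc i)"] by (auto simp: insert_commute)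

lemma path_edges_row:
  assumes "1 \<le> n"
  shows "path_edges (row n a) = insert {{Inl a, Inr (n - 1)}, {Inl a, Inl (Suc a)}}
    ((\<lambda>i. row_edge (a, i)) ` {i. Suc i < n})"
proof -
  have "[0..<n] \<noteq> []" "last [0..<n] = n - 1" using assms by (auto simp: last_upt)
  then show ?thesis
    by (simp add: row_def path_edges_append path_edges_map_upt last_map row_edge_def)
qed

lemma path_edges_row_slides: "1 \<le> n \<Longrightarrow> path_edges (row n a) \<subseteq> slides"
  by (auto simp: path_edges_row row_edge_def intro!: slidesI slide_pair_apex slide_pair_path)

lemma set_row: "set (row n a) = insert {Inl a, Inl (Suc a)} ((\<lambda>i. {Inl a, Inr i}) ` {..<n})"
  by (auto simp: row_def)

text \<open>Induction on the number \<open>j\<close> of rows. The last vertex always contains apex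
  \<open>j\<close>; its value for \<open>j = 0\<close> is the pair \<open>{Inl M, Inl 0}\<close>
  that links \<open>xs\<close> to row 0.\<close>

lemma rows_path:
  assumes "1 \<le> n" "2 \<le> M" "j \<le> M"
    and xs: "distinct xs" "xs \<noteq> []" "set xs = nsets (fan_verts M n) 2" "path_edges xs \<subseteq> slides"
      "last xs = {Inl M, Inr 0}"
  defines "L \<equiv> xs @ [{Inl M, Inl 0}] @ concat (map (row n) [0..<j])"
  shows "distinct L" and "path_edges L \<subseteq> slides" and "path_edges xs \<subseteq> path_edges L"
    and "row_edge ` ({..<j} \<times> {i. Suc i < n}) \<subseteq> path_edges L"
    and "last L = {Inl j, Inl (if j = 0 then M else j - 1)}"
    and "set L = set xs \<union> {{Inl M, Inl 0}} \<union> (\<Union>a<j. set (row n a))"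
proof -
  show "set L = set xs \<union> {{Inl M, Inl 0}} \<union> (\<Union>a<j. set (row n a))"
    by (auto simp: L_def)
  have "distinct L \<and> path_edges L \<subseteq> slides \<and> path_edges xs \<subseteq> path_edges L
    \<and> row_edge ` ({..<j} \<times> {i. Suc i < n}) \<subseteq> path_edges L
    \<and> last L = {Inl j, Inl (if j = 0 then M else j - 1)}"
    unfolding L_def using assms(3)
  proof (induction j)
    case 0
    have "slide {Inl M, Inr 0} {Inl M, Inl 0}" using assms(2) by (intro slide_pair_apex) simp
    then have link: "{last xs, {Inl M, Inl 0}} \<in> slides" unfolding xs(5) by (rule slidesI)
    have "path_edges (xs @ [{Inl M, Inl 0}]) = insert {last xs, {Inl M, Inl 0}} (path_edges xs)"
      using xs(2) by (simp add: path_edges_append)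
    moreover have "{Inl M, Inl 0} \<notin> set xs"
      unfolding xs(3) using assms(2) by (auto simp: nsets_def fan_verts_def)
    ultimately show ?case using xs(1,4) link by (auto simp: insert_commute)
  next
    case (Suc j)
    define K where "K = xs @ [{Inl M, Inl 0}] @ concat (map (row n) [0..<j])"
    have IH: "distinct K" "path_edges K \<subseteq> slides" "path_edges xs \<subseteq> path_edges K"
      "row_edge ` ({..<j} \<times> {i. Suc i < n}) \<subseteq> path_edges K"
      "last K = {Inl j, Inl (if j = 0 then M else j - 1)}"
      using Suc unfolding K_def by auto
    have K: "set K = set xs \<union> {{Inl M, Inl 0}} \<union> (\<Union>a<j. set (row n a))"
      by (auto simp: K_def)
    have eq: "xs @ [{Inl M, Inl 0}] @ concat (map (row n) [0..<Suc j]) = K @ row n j"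
      by (simp add: K_def)
    have ne: "K \<noteq> []" "row n j \<noteq> []" using xs(2) by (auto simp: K_def row_def)
    have hd: "hd (row n j) = {Inl j, Inr 0}"
      using assms(1) by (auto simp: row_def hd_append hd_map)
    have "slide {Inl j, Inr 0} (last K)"
      unfolding IH(5) using assms(2) Suc.prems by (intro slide_pair_apex) auto
    from slidesI[OF slide_sym[OF this]] have link: "{last K, hd (row n j)} \<in> slides"
      unfolding hd .
    have PE: "path_edges (K @ row n j)
        = insert {last K, hd (row n j)} (path_edges K \<union> path_edges (row n j))"
      using ne by (rule path_edges_append)
    have "distinct (row n j)"
      by (auto simp: row_def distinct_map inj_on_def doubleton_eq_iff)
    moreover have "set K \<inter> set (row n j) = {}"
    proof -
      have "Inl j \<notin> X" if "X \<in> set xs" for X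
        using that Suc.prems unfolding xs(3) by (auto simp: nsets_def fan_verts_def)
      moreover have "Inl j \<in> X" if "X \<in> set (row n j)" for X
        using that unfolding set_row by auto
      \<comment> \<open>For \<open>M = 1\<close> this pair would coincide with the link ending row
        0; here \<open>2 \<le> M\<close>.\<close>
      moreover have "{Inl M, Inl 0} \<notin> set (row n j)"
        unfolding set_row using Suc.prems assms(2) by (auto simp: doubleton_eq_iff)
      moreover have "set (row n a) \<inter> set (row n j) = {}" if "a < j" for a
        unfolding set_row using that by (auto simp: doubleton_eq_iff)
      ultimately show ?thesis unfolding K by blast
    qed
    ultimately have D: "distinct (K @ row n j)" using IH(1) by simp
    have PS: "path_edges (K @ row n j) \<subseteq> slides"
      unfolding PE using IH(2) link path_edges_row_slides[OF assms(1)] by simp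
    have PX: "path_edges xs \<subseteq> path_edges (K @ row n j)"
      unfolding PE using IH(3) by (simp add: le_supI1 subset_insertI2)
    have "row_edge ` ({j} \<times> {i. Suc i < n}) \<subseteq> path_edges (row n j)"
      using path_edges_row[OF assms(1), of j] by auto
    moreover have "{..<Suc j} \<times> {i. Suc i < n} = {..<j} \<times> {i. Suc i < n} \<union> {j} \<times> {i. Suc i < n}"
      by (auto simp: less_Suc_eq)
    ultimately have PR: "row_edge ` ({..<Suc j} \<times> {i. Suc i < n}) \<subseteq> path_edges (K @ row n j)"
      unfolding PE using IH(4) by (simp add: image_Un le_supI1 le_supI2 subset_insertI2)
    have "last (K @ row n j) = {Inl (Suc j), Inl j}"
      by (auto simp: row_def)
    then show ?case unfolding eq using D PS PX PR by (intro conjI) simp_all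
  qed
  then show "distinct L" "path_edges L \<subseteq> slides" "path_edges xs \<subseteq> path_edges L"
    "row_edge ` ({..<j} \<times> {i. Suc i < n}) \<subseteq> path_edges L"
    "last L = {Inl j, Inl (if j = 0 then M else j - 1)}" by blast+
qed

text \<open>A pair with \<open>b < M\<close> goes to \<open>a\<close> if \<open>b - a\<close> is at
  most \<open>M div 2\<close>, and otherwise to \<open>b\<close>, counting around the circle. The
  slot index is then less than \<open>M div 2 \<le> n - 1\<close>. Apex \<open>M\<close> lies
  outside the circle and uses slot 0 of row \<open>a\<close>, free because neighbouring apices form
  a link.\<close>

lemma slot_pair_surj:
  assumes n: "2 \<le> n" and M: "2 \<le> M" "M \<le> 2 * n - 1"
    and ab: "a < b" "b \<le> M" "b \<noteq> Suc a" "\<not> (a = 0 \<and> b = M)"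
  shows "{Inl a, Inl b} \<in> slot_pair M ` ({..<M} \<times> {i. Suc i < n})"
proof -
  consider "b = M" | "b < M" "b - a \<le> M div 2" | "b < M" "M div 2 < b - a"
    using ab by linarith
  then show ?thesis
  proof cases
    case 1
    then have "{Inl a, Inl b} = slot_pair M (a, 0)" using ab by (auto simp: slot_pair_def)
    then show ?thesis using n ab by force
  next
    case 2
    then have "{Inl a, Inl b} = slot_pair M (a, b - a - 1)"
      using ab by (auto simp: slot_pair_def)
    moreover have "Suc (b - a - 1) < n" using 2 M n ab by linarith
    ultimately show ?thesis using ab by force
  next
    case 3
    define i where "i = M - (b - a) - 1"
    have "b + i + 1 = a + M" using 3 ab by (simp add: i_def)
    then have "(b + i + 1) mod M = a" using 3 ab by simp
    \<comment> \<open>Slot 0 occurs only for the pair of \<open>0\<close> and \<open>M - 1\<close>.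
      It lies in row \<open>M - 1\<close>, whose slot 0 is not taken by apex
      \<open>M\<close>.\<close>
    moreover have "i = 0 \<Longrightarrow> Suc b = M" using 3 ab by (simp add: i_def)
    ultimately have "{Inl a, Inl b} = slot_pair M (b, i)"
      by (auto simp: slot_pair_def)
    moreover have "Suc i < n" using 3 M n ab unfolding i_def by linarith
    ultimately show ?thesis using 3 by force
  qed
qed

lemma inj_row_edge: "inj row_edge"
  by (auto simp: inj_def row_edge_def doubleton_eq_iff)

text \<open>
  One row per apex: row \<open>M\<close> together with all pairs of path vertices is a path from the
  single-apex fan, the rows \<open>a < M\<close> are traversed along the path graph, and consecutive rows are
  linked by a pair of apices. The other pairs of apices are then inserted into the edges of the
  rows \<open>a < M\<close>.
\<close>

lemma corner_cycle_two_tokens: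
  assumes n: "2 \<le> n" and M: "2 \<le> M" "M \<le> 2 * n - 1"
  shows "\<exists>C. corner_cycle (Suc M) n 2 C"
proof -
  let ?V = "nsets (all_verts (Suc M) n) 2"
  obtain C0 where "fan_cycle M n 2 C0" using fan_cycle_exists[of 2 n M] n by auto
  then have C0: "ham_cycle (nsets (fan_verts M n) 2) C0" "C0 \<subseteq> slides" "corner_edge M 2 \<in> C0"
    "{{Inl M, Inr 1}, {Inl M, Inr 0}} \<in> C0"
    by (auto simp: fan_cycle_def insert_commute)
  \<comment> \<open>Opened at the edge reserved for \<open>k = 2\<close>, the cycle becomes a path
    with apex \<open>M\<close> in both end vertices.\<close>
  obtain xs where xs: "distinct xs" "3 \<le> length xs" "set xs = nsets (fan_verts M n) 2"
    "C0 = cycle_edges xs" "hd xs = {Inl M, Inr 1}" "last xs = {Inl M, Inr 0}"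
    using ham_cycle_open[OF C0(1,4)] by blast
  have ne: "xs \<noteq> []" using xs(2) by auto
  have xs_slides: "path_edges xs \<subseteq> slides" using C0(2) xs(4) by (auto simp: cycle_edges_def)
  have corner: "corner_edge M 2 = {{Inr 0, Inr 1}, {Inl M, Inr 0}}"
    by (auto simp: corner_edge_def numeral_2_eq_2 lessThan_Suc)
  have "corner_edge M 2 \<noteq> {hd xs, last xs}"
    unfolding corner xs(5,6) by (auto simp: doubleton_eq_iff)
  then have corner_xs: "corner_edge M 2 \<in> path_edges xs"
    using C0(3) xs(4) by (auto simp: cycle_edges_def)
  define L where "L = xs @ [{Inl M, Inl 0}] @ concat (map (row n) [0..<M])"
  have n1: "1 \<le> n" using n by simp
  note rows = rows_path[OF n1 M(1) order_refl xs(1) ne xs(3) xs_slides xs(6), folded L_def]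
  define C where "C = cycle_edges L"
  have len: "3 \<le> length L" using xs(2) by (simp add: L_def)
  have C: "ham_cycle (set L) C"
    unfolding ham_cycle_def C_def using rows(1) len by blast
  \<comment> \<open>The link after row \<open>M - 1\<close> contains apex \<open>M\<close> and so
    closes up with the first vertex.\<close>
  have "hd L = {Inl M, Inr 1}" using ne xs(5) by (simp add: L_def)
  moreover have "last L = {Inl M, Inl (M - 1)}" using rows(5) M by simp
  moreover have "slide {Inl M, Inr 1} {Inl M, Inl (M - 1)}"
    using M by (intro slide_pair_apex) simp
  ultimately have C_slides: "C \<subseteq> slides"
    unfolding C_def cycle_edges_def using rows(2) by (auto intro: slidesI)
  have C_corner: "corner_edge M 2 \<in> C"
    using corner_xs rows(3) by (auto simp: C_def cycle_edges_def)
  define T where "T = {..<M} \<times> {i. Suc i < n}"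
  have C_rows: "row_edge ` T \<subseteq> C" using rows(4) by (auto simp: C_def cycle_edges_def T_def)
  have L_sub: "set L \<subseteq> ?V"
    unfolding rows(6) xs(3) set_row using M
    by (auto simp: nsets_def fan_verts_def all_verts_def)
  define U where "U = ?V - set L"
  have "finite (all_verts (Suc M) n)" by (simp add: all_verts_def)
  then have U_fin: "finite U" by (simp add: U_def finite_imp_finite_nsets)
  \<comment> \<open>\<open>L\<close> visits every pair with a path vertex, as well as the links;
    only pairs of non-consecutive apices other than \<open>{0, M}\<close> remain.\<close>
  have U_pair: "\<exists>a b. u = {Inl a, Inl b} \<and> a < b \<and> b \<le> M \<and> b \<noteq> Suc a \<and> \<not> (a = 0 \<and> b = M)"
    if u: "u \<in> U" for u
  proof -
    have "u \<in> ?V" and notin: "u \<notin> set L" using u by (auto simp: U_def)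
    then obtain p q where pq: "u = {p, q}" "p \<noteq> q" "p \<in> all_verts (Suc M) n" "q \<in> all_verts (Suc M) n"
      by (auto simp: nsets_def card_2_iff)
    have no_fan: "\<not> (p \<in> fan_verts M n \<and> q \<in> fan_verts M n)"
      using notin pq unfolding rows(6) xs(3) by (auto simp: nsets_def)
    have "(p, q) \<notin> Inl ` {..<M} \<times> Inr ` {..<n}" "(q, p) \<notin> Inl ` {..<M} \<times> Inr ` {..<n}"
      using notin unfolding rows(6) set_row pq(1) by (auto simp: insert_commute)
    note no_row = this
    have no_link: "u \<noteq> {Inl a, Inl (Suc a)}" if "a < M" for a
      using notin that unfolding rows(6) set_row by auto
    have no_0M: "u \<noteq> {Inl M, Inl 0}" using notin unfolding rows(6) by auto
    have "\<exists>a b. p = Inl a \<and> q = Inl b"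
      using pq no_fan no_row
      by (auto simp: all_verts_def fan_verts_def less_Suc_eq)
    then obtain a b where p: "p = Inl a" and q: "q = Inl b" by blast
    have le: "a \<le> M" "b \<le> M" using pq(3,4) by (auto simp: p q all_verts_def)
    have "a \<noteq> b" using pq(2) p q by simp
    then consider "a < b" | "b < a" by linarith
    then show ?thesis
    proof cases
      case 1
      then show ?thesis using no_link[of a] no_0M le pq(1) p q
        by (intro exI[of _ a] exI[of _ b]) (auto simp: insert_commute)
    next
      case 2
      then show ?thesis using no_link[of b] no_0M le pq(1) p q
        by (intro exI[of _ b] exI[of _ a]) (auto simp: insert_commute)
    qed
  qed
  have U_slot: "U \<subseteq> slot_pair M ` T"
    unfolding T_def using U_pair slot_pair_surj[OF n M] by blast
  \<comment> \<open>Choosing one slot for each remaining pair is injective, and so is passing from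
    slots to edges.\<close>
  define s where "s = row_edge \<circ> inv_into T (slot_pair M)"
  have inv: "inv_into T (slot_pair M) u \<in> T \<and> slot_pair M (inv_into T (slot_pair M) u) = u"
    if "u \<in> U" for u
    using U_slot that by (meson inv_into_into f_inv_into_f subsetD)
  have s_T: "s ` U \<subseteq> row_edge ` T" using inv by (auto simp: s_def)
  have "\<exists>E. ham_cycle (U \<union> set L) E \<and> E \<subseteq> slides \<and> C - s ` U \<subseteq> E"
  proof (rule ham_cycle_insert_set[OF U_fin C])
    show "U \<inter> set L = {}" by (auto simp: U_def)
    show "inj_on s U"
      unfolding s_def
      by (intro comp_inj_on inj_on_subset[OF inj_row_edge] inj_on_inv_into[OF U_slot]) simp
    show "s ` U \<subseteq> C" using s_T C_rows by (rule order_trans)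
    show "C \<subseteq> slides" by (rule C_slides)
  next
    fix u x assume u: "u \<in> U" and x: "x \<in> s u"
    obtain a i where ai: "inv_into T (slot_pair M) u = (a, i)" by force
    then have "u = slot_pair M (a, i)" using inv[OF u] by simp
    then obtain b where b: "u = {Inl a, Inl b}" by (auto simp: slot_pair_def)
    then have "b \<noteq> a" using U_pair[OF u] by (auto simp: doubleton_eq_iff)
    moreover obtain j where "x = {Inl a, Inr j}" using x ai by (auto simp: s_def row_edge_def)
    ultimately show "{x, u} \<in> slides" using b by (auto intro: slidesI slide_pair_apex)
  next
    fix e assume "e \<in> slides"
    then show "\<exists>x y. e = {x, y}"
      unfolding slides_def mem_Collect_eq by (elim exE conjE) (rule exI)+
  qed
  then obtain E where E: "ham_cycle (U \<union> set L) E" "E \<subseteq> slides" "C - s ` U \<subseteq> E"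
    by (elim exE conjE)
  have "U \<union> set L = ?V" using L_sub by (auto simp: U_def)
  then have "ham_cycle ?V E" using E(1) by simp
  \<comment> \<open>Every end of a row edge contains an apex, so the insertions leave the corner
    edge intact.\<close>
  moreover have "{Inr 0, Inr 1} \<notin> row_edge t" for t
    by (cases t) (auto simp: row_edge_def doubleton_eq_iff)
  then have "corner_edge M 2 \<noteq> row_edge t" for t
    unfolding corner by (metis insertI1)
  then have "corner_edge M 2 \<notin> s ` U" unfolding s_def comp_def by (metis imageE)
  then have "corner_edge M 2 \<in> E" using C_corner by (intro subsetD[OF E(3)] DiffI)
  ultimately have "corner_cycle (Suc M) n 2 E" using E(2) by (simp add: corner_cycle_def)
  then show ?thesis by (rule exI[of _ E])
qed

section \<open>Adding apices\<close>

text \<open>Both cycles are cut at their corner edges. From \<open>{0..<k + 1}\<close> the token on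
  \<open>k\<close> moves to the new apex, from \<open>{0..<k} + w\<close> the token on
  \<open>k - 1\<close>. The first of these moves is the corner edge for the new apex.\<close>

lemma corner_cycle_merge:
  assumes C: "corner_cycle m n (Suc k) C" and D: "corner_cycle m n k D"
    and mk: "1 \<le> m" "1 \<le> k"
  shows "\<exists>E. corner_cycle (Suc m) n (Suc k) E"
proof -
  define w x :: "nat + nat" where "w = Inl (m - 1)" and "x = Inl m"
  let ?P = "Inr ` {..<k} :: (nat + nat) set" and ?Q = "insert w (Inr ` {..<k - 1})"
  have "w \<noteq> x" using mk by (simp add: w_def x_def)
  have verts: "all_verts (Suc m) n = insert x (all_verts m n)"
    by (auto simp: all_verts_def x_def lessThan_Suc)
  have x: "x \<notin> all_verts m n" by (auto simp: all_verts_def x_def)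
  have XY: "{insert (Inr k) ?P, insert w ?P} \<in> C"
    using C by (simp add: corner_cycle_def corner_edge_def w_def lessThan_Suc)
  have AB: "{?P, ?Q} \<in> D"
    using D by (simp add: corner_cycle_def corner_edge_def w_def)
  have sX: "slide (insert (Inr k) ?P) (insert x ?P)"
    by (rule slideI) (auto simp: x_def)
  have "{..<k} = insert (k - 1) {..<k - 1}" using mk by auto
  then have "insert w ?P = insert (Inr (k - 1)) ?Q" by auto
  moreover have "slide (insert (Inr (k - 1)) ?Q) (insert x ?Q)"
    using \<open>w \<noteq> x\<close> by (intro slideI) (auto simp: w_def x_def)
  ultimately have sY: "slide (insert w ?P) (insert x ?Q)" by simp
  have C': "ham_cycle (nsets (all_verts m n) (Suc k)) C" "C \<subseteq> slides"
    and D': "ham_cycle (nsets (all_verts m n) k) D" "D \<subseteq> slides"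
    using C D by (simp_all add: corner_cycle_def)
  obtain E where E: "ham_cycle (nsets (insert x (all_verts m n)) (Suc k)) E" "E \<subseteq> slides"
    "{insert (Inr k) ?P, insert x ?P} \<in> E"
    using ham_cycle_tokens_merge[OF C' D' x XY AB sX sY] by (elim exE conjE)
  have "corner_edge m (Suc k) = {insert (Inr k) ?P, insert x ?P}"
    by (simp add: corner_edge_def x_def lessThan_Suc)
  then show ?thesis using E verts by (auto simp: corner_cycle_def)
qed

lemma corner_cycle_one:
  assumes "1 \<le> k" "k \<le> n" "2 \<le> n"
  shows "\<exists>C. corner_cycle 1 n k C"
proof -
  obtain C where "fan_cycle 0 n k C" using fan_cycle_exists assms by blast
  moreover have "all_verts 1 n = fan_verts 0 n"
    by (auto simp: all_verts_def fan_verts_def)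
  ultimately show ?thesis by (auto simp: fan_cycle_def corner_cycle_def)
qed

text \<open>Induction on \<open>m\<close>: for \<open>k \<ge> 3\<close> the hypothesis covers both
  \<open>k\<close> and \<open>k - 1\<close>. For \<open>k = 2\<close> the explicit cycle takes over
  once there are at least three apices.\<close>

lemma corner_cycle_exists:
  assumes "1 \<le> m" "m \<le> 2 * n" "2 \<le> k" "k \<le> n"
  shows "\<exists>C. corner_cycle m n k C"
  using assms
proof (induction m arbitrary: k rule: dec_induct)
  case base
  then show ?case using corner_cycle_one[of k n] by auto
next
  case (step m)
  obtain C where C: "corner_cycle m n k C" using step by auto
  consider "k = 2" "2 \<le> m" | "k = 2" "m = 1" | "3 \<le> k" using step by linarith
  then show ?case
  proof cases
    case 1
    then show ?thesis using corner_cycle_two_tokens[of n m] step by auto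
  next
    case 2
    \<comment> \<open>With one apex the fan itself is Hamiltonian, so the passage to two apices can
      still be made by merging.\<close>
    obtain D where "corner_cycle 1 n 1 D" using corner_cycle_one[of 1 n] step by auto
    then show ?thesis using corner_cycle_merge[of 1 n 1 C D] C 2 by (auto simp: numeral_2_eq_2)
  next
    case 3
    then obtain D where "corner_cycle m n (k - 1) D" using step by fastforce
    then show ?thesis using corner_cycle_merge[of m n "k - 1" C D] C 3 step by auto
  qed
qed

section \<open>From edge sets to directed cycles in the token graph\<close>

lemma pcas_zip: "pcas x (zip (x # xs) (xs @ [y])) y"
  by (induction xs arbitrary: x) auto

lemma pawalk_verts_zip: "pawalk_verts x (zip (x # xs) (xs @ [y])) = x # xs @ [y]"
  by (induction xs arbitrary: x) auto

lemma zip_path_edges: "(a, b) \<in> set (zip (x # xs) (xs @ [y])) \<Longrightarrow> {a, b} \<in> path_edges (x # xs @ [y])"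
  by (induction xs arbitrary: x) auto

lemma hamiltonian_of_ham_cycle:
  assumes "ham_cycle (pverts G) C" and arcs: "\<And>a b. {a, b} \<in> C \<Longrightarrow> (a, b) \<in> parcs G"
  shows "hamiltonian G"
proof -
  obtain xs where xs: "distinct xs" "3 \<le> length xs" "set xs = pverts G" "C = cycle_edges xs"
    using assms(1) unfolding ham_cycle_def by blast
  obtain x ys where eq: "xs = x # ys" using xs(2) by (cases xs) auto
  \<comment> \<open>The arcs of the closed walk pair the vertex list with its rotation by
    one.\<close>
  define p where "p = zip (x # ys) (ys @ [x])"
  have "cycle_edges xs = path_edges (xs @ [x])"
    using eq by (simp add: cycle_edges_def path_edges_append insert_commute del: append_Cons)
  then have "set p \<subseteq> parcs G"
    using zip_path_edges[of _ _ x ys x] arcs xs(4) eq by (auto simp: p_def)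
  moreover have "x \<in> pverts G" using xs(3) eq by auto
  ultimately have "pre_digraph.awalk (with_proj G) x p x"
    by (simp add: pre_digraph.awalk_def cas_with_proj_eq p_def pcas_zip)
  moreover have "distinct (tl (pre_digraph.awalk_verts (with_proj G) x p))"
    using xs(1) eq by (simp add: awalk_verts_with_proj_eq p_def pawalk_verts_zip)
  moreover have "3 \<le> length p" using xs(2) eq by (simp add: p_def)
  moreover have "map fst p = xs" using eq by (simp add: p_def)
  then have "fst ` set p = pverts G" using xs(3) by (metis set_map)
  ultimately show ?thesis
    unfolding hamiltonian_def pre_digraph.cycle_def by (intro exI[of _ p]) auto
qed

lemma pverts_fan_graph: "pverts (fan_graph m n) = all_verts m n"
  by (auto simp: fan_graph_def graph_join_def edgeless_graph_def path_graph_def all_verts_def)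

lemma parcs_fan_graph:
  "fan_adj u v \<Longrightarrow> u \<in> all_verts m n \<Longrightarrow> v \<in> all_verts m n \<Longrightarrow> (u, v) \<in> parcs (fan_graph m n)"
  by (cases "(u, v)" rule: fan_adj.cases)
    (auto simp: fan_graph_def graph_join_def edgeless_graph_def path_graph_def all_verts_def)

theorem theorem2:
  fixes k n m :: nat
  assumes "k \<ge> 2" and "n \<ge> k" and "1 \<le> m" and "m \<le> 2 * n"
  shows "hamiltonian (token_graph k (fan_graph m n))"
proof -
  obtain C where C: "ham_cycle (nsets (all_verts m n) k) C" "C \<subseteq> slides"
    using corner_cycle_exists[of m n k] assms by (auto simp: corner_cycle_def)
  have "(A, B) \<in> parcs (token_graph k (fan_graph m n))" if AB: "{A, B} \<in> C" for A B
  proof -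
    have sub: "A \<in> nsets (all_verts m n) k" "B \<in> nsets (all_verts m n) k"
      using ham_cycle_subset[OF C(1) AB] by auto
    obtain S u v where S: "u \<notin> S" "v \<notin> S" "fan_adj u v" "A = insert u S" "B = insert v S"
      using slidesD[OF subsetD[OF C(2) AB]] unfolding slide_def by (elim exE conjE)
    \<comment> \<open>Since \<open>fan_adj\<close> is loop-free and \<open>u\<close>,
      \<open>v\<close> lie outside the resting tokens \<open>S\<close>, the symmetric difference is
      exactly \<open>{u, v}\<close>.\<close>
    have "u \<noteq> v" using S(3) by (cases u) auto
    then have "sym_diff A B = {u, v}" using S by auto
    moreover have "(u, v) \<in> parcs (fan_graph m n)"
      using sub S by (intro parcs_fan_graph) (auto simp: nsets_def)
    ultimately show ?thesis using sub by (auto simp: token_graph_def pverts_fan_graph)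
  qed
  moreover have "pverts (token_graph k (fan_graph m n)) = nsets (all_verts m n) k"
    by (simp add: token_graph_def pverts_fan_graph)
  ultimately show ?thesis using hamiltonian_of_ham_cycle C(1) by metis
qed

end
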